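(* Let $\mathcal Q$ be a quasivariety. If every finitely presented algebra in $\mathcal Q$ is exact, then $\mathcal Q$ is universally complete.
   Context: For a quasivariety $\mathcal Q$, $\mathbf F_{\mathcal Q}(X)$ is the free algebra on $X$ and $\mathbf F_{\mathcal Q}(\omega)$ the free algebra on countably many generators. An algebra is finitely presented in $\mathcal Q$ if isomorphic to $\mathbf F_{\mathcal Q}(X)/\theta_{\mathcal Q}(H)$ with $X,H$ finite ($\theta_{\mathcal Q}(H)$ the least congruence containing $H$ with quotient in $\mathcal Q$). A finitely generated algebra of $\mathcal Q$ is exact iff it is isomorphic to a subalgebra of $\mathbf F_{\mathcal Q}(\omega)$. A universal sentence $\Sigma\Rightarrow\Delta$ ($\Sigma,\Delta$ finite sets of equations) is valid in an algebra if every assignment satisfying all of $\Sigma$ satisfies some equation of $\Delta$; it is admissible in $\mathcal Q$ if every substitution (homomorphism from terms to $\mathbf F_{\mathcal Q}(\omega)$) identifying both sides of every equation of $\Sigma$ identifies both sides of some equation of $\Delta$. $\mathcal Q$ is universally complete if every admissible universal sentence is valid in $\mathcal Q$. *)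

theory Defs
  imports Main
begin

text \<open>
  A signature carries an explicit set of operation symbols, so that the signature without
  operations is covered although every HOL type is inhabited.
\<close>

record 'f signature =
  ops :: "'f set"
  arity :: "'f \<Rightarrow> nat"

record ('f, 'a) alg =
  carr :: "'a set"
  interp :: "'f \<Rightarrow> 'a list \<Rightarrow> 'a"

definition closed_under_ops :: "'f signature \<Rightarrow> ('f, 'a) alg \<Rightarrow> 'a set \<Rightarrow> bool" where
  "closed_under_ops S A U \<longleftrightarrow>
     (\<forall>f \<in> ops S. \<forall>xs. length xs = arity S f \<and> set xs \<subseteq> U \<longrightarrow> interp A f xs \<in> U)"

definition algebra :: "'f signature \<Rightarrow> ('f, 'a) alg \<Rightarrow> bool" where
  "algebra S A \<longleftrightarrow> carr A \<noteq> {} \<and> closed_under_ops S A (carr A)"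

definition alg_hom :: "'f signature \<Rightarrow> ('f, 'a) alg \<Rightarrow> ('f, 'b) alg \<Rightarrow> ('a \<Rightarrow> 'b) set" where
  "alg_hom S A B = {h. h ` carr A \<subseteq> carr B \<and>
     (\<forall>f \<in> ops S. \<forall>xs. length xs = arity S f \<and> set xs \<subseteq> carr A \<longrightarrow>
        h (interp A f xs) = interp B f (map h xs))}"

definition alg_iso :: "'f signature \<Rightarrow> ('f, 'a) alg \<Rightarrow> ('f, 'b) alg \<Rightarrow> bool" where
  "alg_iso S A B \<longleftrightarrow> (\<exists>h \<in> alg_hom S A B. bij_betw h (carr A) (carr B))"

definition subuniverse :: "'f signature \<Rightarrow> ('f, 'a) alg \<Rightarrow> 'a set \<Rightarrow> bool" where
  "subuniverse S A U \<longleftrightarrow> U \<noteq> {} \<and> U \<subseteq> carr A \<and> closed_under_ops S A U"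

definition subalgebra :: "'f signature \<Rightarrow> ('f, 'a) alg \<Rightarrow> ('f, 'a) alg \<Rightarrow> bool" where
  "subalgebra S B A \<longleftrightarrow> (\<exists>U. subuniverse S A U \<and> B = A\<lparr>carr := U\<rparr>)"

definition finitely_generated :: "'f signature \<Rightarrow> ('f, 'a) alg \<Rightarrow> bool" where
  "finitely_generated S A \<longleftrightarrow>
     (\<exists>G. finite G \<and> G \<subseteq> carr A \<and> (\<forall>U. subuniverse S A U \<and> G \<subseteq> U \<longrightarrow> U = carr A))"

definition congruence :: "'f signature \<Rightarrow> ('f, 'a) alg \<Rightarrow> ('a \<times> 'a) set \<Rightarrow> bool" where
  "congruence S A \<theta> \<longleftrightarrow> equiv (carr A) \<theta> \<and>
     (\<forall>f \<in> ops S. \<forall>xs ys. length xs = arity S f \<and> list_all2 (\<lambda>x y. (x, y) \<in> \<theta>) xs ys \<longrightarrow>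
        (interp A f xs, interp A f ys) \<in> \<theta>)"

definition quotient_alg :: "('f, 'a) alg \<Rightarrow> ('a \<times> 'a) set \<Rightarrow> ('f, 'a set) alg" where
  "quotient_alg A \<theta> =
     \<lparr>carr = carr A // \<theta>,
      interp = (\<lambda>f Cs. \<theta> `` {interp A f (map (\<lambda>C. SOME x. x \<in> C) Cs)})\<rparr>"

text \<open>Terms have variables in \<open>nat\<close>, which plays the role of \<open>\<omega>\<close>.\<close>

datatype 'f trm = Var nat | App 'f "'f trm list"

inductive_set terms :: "'f signature \<Rightarrow> nat set \<Rightarrow> 'f trm set" for S X where
  "x \<in> X \<Longrightarrow> Var x \<in> terms S X"
| "f \<in> ops S \<Longrightarrow> length ts = arity S f \<Longrightarrow> \<forall>t \<in> set ts. t \<in> terms S X \<Longrightarrow> App f ts \<in> terms S X"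

definition term_alg :: "'f signature \<Rightarrow> nat set \<Rightarrow> ('f, 'f trm) alg" where
  "term_alg S X = \<lparr>carr = terms S X, interp = App\<rparr>"

primrec eval :: "('f, 'a) alg \<Rightarrow> (nat \<Rightarrow> 'a) \<Rightarrow> 'f trm \<Rightarrow> 'a" where
  "eval A v (Var x) = v x"
| "eval A v (App f ts) = interp A f (map (eval A v) ts)"

type_synonym 'f eqn = "'f trm \<times> 'f trm"

definition equations :: "'f signature \<Rightarrow> 'f eqn set" where
  "equations S = terms S UNIV \<times> terms S UNIV"

definition universal_sentence :: "'f signature \<Rightarrow> 'f eqn set \<Rightarrow> 'f eqn set \<Rightarrow> bool" where
  "universal_sentence S \<Sigma> \<Delta> \<longleftrightarrow>
     finite \<Sigma> \<and> finite \<Delta> \<and> \<Sigma> \<subseteq> equations S \<and> \<Delta> \<subseteq> equations S"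

definition valid_in :: "('f, 'a) alg \<Rightarrow> 'f eqn set \<Rightarrow> 'f eqn set \<Rightarrow> bool" where
  "valid_in A \<Sigma> \<Delta> \<longleftrightarrow> (\<forall>v. range v \<subseteq> carr A \<longrightarrow>
     (\<forall>(s, t) \<in> \<Sigma>. eval A v s = eval A v t) \<longrightarrow> (\<exists>(s, t) \<in> \<Delta>. eval A v s = eval A v t))"

text \<open>
  HOL has no object collecting algebras over all carrier types, so a quasivariety is given
  by a set \<open>\<Phi>\<close> of axiomatizing quasiequations; a quasiequation \<open>(\<Sigma>, e)\<close> is the universal
  sentence with the single conclusion \<open>e\<close>.
\<close>

definition quasiequations :: "'f signature \<Rightarrow> ('f eqn set \<times> 'f eqn) set \<Rightarrow> bool" where
  "quasiequations S \<Phi> \<longleftrightarrow> (\<forall>(\<Sigma>, e) \<in> \<Phi>. universal_sentence S \<Sigma> {e})"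

definition in_quasivariety ::
  "'f signature \<Rightarrow> ('f eqn set \<times> 'f eqn) set \<Rightarrow> ('f, 'a) alg \<Rightarrow> bool" where
  "in_quasivariety S \<Phi> A \<longleftrightarrow> algebra S A \<and> (\<forall>(\<Sigma>, e) \<in> \<Phi>. valid_in A \<Sigma> {e})"

text \<open>
  Relative congruences are closed under intersection because quasivarieties are closed under
  subdirect products, so this intersection is the least one containing \<open>H\<close>.
\<close>

definition least_rel_congruence ::
  "'f signature \<Rightarrow> ('f eqn set \<times> 'f eqn) set \<Rightarrow> ('f, 'a) alg \<Rightarrow> ('a \<times> 'a) set \<Rightarrow> ('a \<times> 'a) set" where
  "least_rel_congruence S \<Phi> A H =
     \<Inter>{\<theta>. congruence S A \<theta> \<and> H \<subseteq> \<theta> \<and> in_quasivariety S \<Phi> (quotient_alg A \<theta>)}"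

text \<open>
  The free algebra on \<open>X\<close>, constructed as the largest quotient of the term algebra over \<open>X\<close>
  that lies in the quasivariety.
\<close>

definition free_alg ::
  "'f signature \<Rightarrow> ('f eqn set \<times> 'f eqn) set \<Rightarrow> nat set \<Rightarrow> ('f, 'f trm set) alg" where
  "free_alg S \<Phi> X =
     quotient_alg (term_alg S X) (least_rel_congruence S \<Phi> (term_alg S X) {})"

text \<open>
  If \<open>X = {}\<close> and there are no constants, then \<open>free_alg S \<Phi> X\<close> has an empty carrier; the first
  conjunct excludes this case.
\<close>

definition finitely_presented ::
  "'f signature \<Rightarrow> ('f eqn set \<times> 'f eqn) set \<Rightarrow> ('f, 'a) alg \<Rightarrow> bool" where
  "finitely_presented S \<Phi> A \<longleftrightarrow> in_quasivariety S \<Phi> A \<and>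
     (\<exists>X H. finite X \<and> finite H \<and> H \<subseteq> carr (free_alg S \<Phi> X) \<times> carr (free_alg S \<Phi> X) \<and>
        alg_iso S A
          (quotient_alg (free_alg S \<Phi> X) (least_rel_congruence S \<Phi> (free_alg S \<Phi> X) H)))"

definition exact ::
  "'f signature \<Rightarrow> ('f eqn set \<times> 'f eqn) set \<Rightarrow> ('f, 'a) alg \<Rightarrow> bool" where
  "exact S \<Phi> A \<longleftrightarrow> in_quasivariety S \<Phi> A \<and> finitely_generated S A \<and>
     (\<exists>B. subalgebra S B (free_alg S \<Phi> UNIV) \<and> alg_iso S A B)"

definition admissible ::
  "'f signature \<Rightarrow> ('f eqn set \<times> 'f eqn) set \<Rightarrow> 'f eqn set \<Rightarrow> 'f eqn set \<Rightarrow> bool" where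
  "admissible S \<Phi> \<Sigma> \<Delta> \<longleftrightarrow> (\<forall>\<sigma> \<in> alg_hom S (term_alg S UNIV) (free_alg S \<Phi> UNIV).
     (\<forall>(s, t) \<in> \<Sigma>. \<sigma> s = \<sigma> t) \<longrightarrow> (\<exists>(s, t) \<in> \<Delta>. \<sigma> s = \<sigma> t))"

text \<open>
  The type argument is the type of the carrier elements; a theorem in which it is a type
  variable speaks about all algebras of the quasivariety.
\<close>

definition universally_complete ::
  "'a itself \<Rightarrow> 'f signature \<Rightarrow> ('f eqn set \<times> 'f eqn) set \<Rightarrow> bool" where
  "universally_complete TYPE('a) S \<Phi> \<longleftrightarrow>
     (\<forall>\<Sigma> \<Delta>. universal_sentence S \<Sigma> \<Delta> \<and> admissible S \<Phi> \<Sigma> \<Delta> \<longrightarrow>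
        (\<forall>A :: ('f, 'a) alg. in_quasivariety S \<Phi> A \<longrightarrow> valid_in A \<Sigma> \<Delta>))"

text \<open>
  Every finitely presented algebra, over whatever carrier type, is isomorphic to one whose
  elements are classes of classes of terms, and exactness is invariant under isomorphism.
  Quantifying over algebras of this carrier type therefore covers all finitely presented
  algebras.
\<close>

definition all_finitely_presented_exact ::
  "'f signature \<Rightarrow> ('f eqn set \<times> 'f eqn) set \<Rightarrow> bool" where
  "all_finitely_presented_exact S \<Phi> \<longleftrightarrow>
     (\<forall>A :: ('f, 'f trm set set) alg. finitely_presented S \<Phi> A \<longrightarrow> exact S \<Phi> A)"

end

theory Submission
  imports Defs
begin

text \<open>
  Let \<open>v\<close> satisfy \<open>\<Sigma>\<close> in \<open>A\<close>, and let \<open>P = F(X)/\<theta>(H)\<close> be presented by the finitely many variables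
  of \<open>\<Sigma>\<close> and \<open>\<Delta>\<close> with relations \<open>\<Sigma>\<close>. An embedding of \<open>P\<close> into \<open>F(\<omega>)\<close> yields a substitution
  that identifies exactly those terms over \<open>X\<close> that are identified in \<open>P\<close>. It unifies \<open>\<Sigma>\<close>, so by
  admissibility some equation of \<open>\<Delta>\<close> holds for the generators of \<open>P\<close>; since \<open>v\<close> induces a
  homomorphism from \<open>P\<close> to \<open>A\<close>, this equation holds in \<open>A\<close> under \<open>v\<close>.
\<close>

section \<open>Homomorphisms and evaluation of terms\<close>

lemma alg_homI:
  assumes "\<And>x. x \<in> carr A \<Longrightarrow> h x \<in> carr B"
    and "\<And>f xs. f \<in> ops S \<Longrightarrow> length xs = arity S f \<Longrightarrow> set xs \<subseteq> carr A \<Longrightarrow>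
      h (interp A f xs) = interp B f (map h xs)"
  shows "h \<in> alg_hom S A B"
  using assms unfolding alg_hom_def by auto

lemma alg_hom_carr: "h \<in> alg_hom S A B \<Longrightarrow> x \<in> carr A \<Longrightarrow> h x \<in> carr B"
  unfolding alg_hom_def by auto

lemma alg_hom_interp:
  "h \<in> alg_hom S A B \<Longrightarrow> f \<in> ops S \<Longrightarrow> length xs = arity S f \<Longrightarrow> set xs \<subseteq> carr A \<Longrightarrow>
    h (interp A f xs) = interp B f (map h xs)"
  unfolding alg_hom_def by auto

lemma alg_hom_comp:
  assumes g: "g \<in> alg_hom S B C" and h: "h \<in> alg_hom S A B"
  shows "g \<circ> h \<in> alg_hom S A C"
proof (rule alg_homI)
  fix f xs assume f: "f \<in> ops S" "length xs = arity S f" "set xs \<subseteq> carr A"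
  have "set (map h xs) \<subseteq> carr B" using f(3) alg_hom_carr[OF h] by auto
  then show "(g \<circ> h) (interp A f xs) = interp C f (map (g \<circ> h) xs)"
    using f by (simp add: alg_hom_interp[OF h] alg_hom_interp[OF g])
qed (simp add: alg_hom_carr[OF g] alg_hom_carr[OF h])

lemma algebra_interp:
  "algebra S A \<Longrightarrow> f \<in> ops S \<Longrightarrow> length xs = arity S f \<Longrightarrow> set xs \<subseteq> carr A \<Longrightarrow> interp A f xs \<in> carr A"
  unfolding algebra_def closed_under_ops_def by auto

lemma eval_carr:
  assumes "algebra S A" "t \<in> terms S X" "w ` X \<subseteq> carr A"
  shows "eval A w t \<in> carr A"
  using assms(2)
proof induction
  case (2 f ts)
  then show ?case using algebra_interp[OF assms(1), of f "map (eval A w) ts"] by auto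
qed (use assms in auto)

lemma eval_alg_hom:
  assumes "algebra S A" "w ` X \<subseteq> carr A"
  shows "eval A w \<in> alg_hom S (term_alg S X) A"
  by (rule alg_homI) (auto simp: term_alg_def intro: eval_carr[OF assms(1) _ assms(2)])

lemma alg_hom_eval:
  assumes "h \<in> alg_hom S A B" "algebra S A" "w ` X \<subseteq> carr A" "t \<in> terms S X"
  shows "h (eval A w t) = eval B (h \<circ> w) t"
  using assms(4)
proof induction
  case (2 f ts)
  have "set (map (eval A w) ts) \<subseteq> carr A"
    using 2 eval_carr[OF assms(2) _ assms(3)] by auto
  then have "h (eval A w (App f ts)) = interp B f (map h (map (eval A w) ts))"
    using 2 by (simp add: alg_hom_interp[OF assms(1)])
  also have "map h (map (eval A w) ts) = map (eval B (h \<circ> w)) ts"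
    using 2 by (simp add: comp_def)
  finally show ?case by (simp add: comp_def)
qed simp

text \<open>Variables generate the term algebra, so induction on terms reduces the claim to them.
  Agreement is required on \<open>X\<close> only, which leaves \<open>w\<close> free elsewhere; a
  valuation of all variables can thus be compared with a homomorphism on terms over
  \<open>X\<close>.\<close>

lemma term_alg_hom_eq_eval:
  assumes "h \<in> alg_hom S (term_alg S X) B" "t \<in> terms S X" "\<And>x. x \<in> X \<Longrightarrow> w x = h (Var x)"
  shows "h t = eval B w t"
  using assms(2)
proof induction
  case (2 f ts)
  have "h (interp (term_alg S X) f ts) = interp B f (map h ts)"
    using 2 by (intro alg_hom_interp[OF assms(1)]) (auto simp: term_alg_def)
  also have "map h ts = map (eval B w) ts"
    using 2 by auto
  finally show ?case by (simp add: term_alg_def)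
qed (use assms in auto)

text \<open>One variable makes the carrier nonempty even in a signature without constants.\<close>

lemma algebra_term_alg: "X \<noteq> {} \<Longrightarrow> algebra S (term_alg S X)"
  unfolding algebra_def closed_under_ops_def term_alg_def
  by (auto intro: terms.intros)

section \<open>Finite sets of variables\<close>

lemma terms_mono:
  assumes "t \<in> terms S X" "X \<subseteq> Y" shows "t \<in> terms S Y"
  using assms(1) by induction (use assms(2) in \<open>auto intro: terms.intros\<close>)

text \<open>The union of one finite variable set per term suffices. This serves both the argument
  lists of operation symbols and the collection of all sides of the equations in a sentence.\<close>

lemma finite_terms_finite_vars:
  assumes "finite T" "\<forall>t\<in>T. \<exists>X. finite X \<and> t \<in> terms S X"
  shows "\<exists>X. finite X \<and> T \<subseteq> terms S X"
proof -
  obtain V where V: "\<forall>t\<in>T. finite (V t) \<and> t \<in> terms S (V t)"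
    using assms(2) by metis
  then have "T \<subseteq> terms S (\<Union>t\<in>T. V t)"
    by (blast intro: terms_mono)
  then show ?thesis using V assms(1) by blast
qed

lemma term_finite_vars:
  assumes "t \<in> terms S Y" shows "\<exists>X. finite X \<and> t \<in> terms S X"
  using assms
proof induction
  case (1 x)
  then show ?case by (intro exI[of _ "{x}"]) (auto intro: terms.intros)
next
  case (2 f ts)
  then have "\<forall>t\<in>set ts. \<exists>X. finite X \<and> t \<in> terms S X" by auto
  then obtain X where "finite X" "set ts \<subseteq> terms S X"
    using finite_terms_finite_vars[OF finite_set] by metis
  then have "App f ts \<in> terms S X"
    using 2(1,2) by (intro terms.intros) auto
  then show ?case using \<open>finite X\<close> by blast
qed

section \<open>Congruences and quotient algebras\<close>

lemma congruence_equiv: "congruence S A \<theta> \<Longrightarrow> equiv (carr A) \<theta>"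
  unfolding congruence_def by auto

lemma carr_quotient_alg [simp]: "carr (quotient_alg A \<theta>) = carr A // \<theta>"
  by (simp add: quotient_alg_def)

text \<open>The quotient operation works on representatives picked by \<open>SOME\<close>, which may
  differ from the entries of \<open>xs\<close>. Each is congruent to its entry, so compatibility
  with \<open>f\<close> puts both results into the same class.\<close>

lemma quotient_alg_interp:
  assumes c: "congruence S A \<theta>" and f: "f \<in> ops S" "length xs = arity S f" "set xs \<subseteq> carr A"
  shows "interp (quotient_alg A \<theta>) f (map (\<lambda>x. \<theta> `` {x}) xs) = \<theta> `` {interp A f xs}"
proof -
  have e: "equiv (carr A) \<theta>" by (rule congruence_equiv[OF c])
  have "(x, SOME y. y \<in> \<theta> `` {x}) \<in> \<theta>" if "x \<in> set xs" for x
    using someI[of "\<lambda>y. y \<in> \<theta> `` {x}" x] equiv_class_self[OF e, of x] that f(3) by auto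
  then have "list_all2 (\<lambda>x y. (x, y) \<in> \<theta>) xs
      (map (\<lambda>C. SOME y. y \<in> C) (map (\<lambda>x. \<theta> `` {x}) xs))"
    by (auto simp: list_all2_conv_all_nth)
  then have "(interp A f xs,
      interp A f (map (\<lambda>C. SOME y. y \<in> C) (map (\<lambda>x. \<theta> `` {x}) xs))) \<in> \<theta>"
    using c f unfolding congruence_def by blast
  then show ?thesis
    unfolding quotient_alg_def using equiv_class_eq[OF e] by force
qed

lemma quotient_alg_hom:
  assumes "congruence S A \<theta>"
  shows "(\<lambda>x. \<theta> `` {x}) \<in> alg_hom S A (quotient_alg A \<theta>)"
  using quotient_alg_interp[OF assms] by (auto intro!: alg_homI quotientI)

lemma quotient_list_representatives:
  assumes "set Cs \<subseteq> A // \<theta>"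
  obtains xs where "set xs \<subseteq> A" "Cs = map (\<lambda>x. \<theta> `` {x}) xs"
proof -
  have "\<exists>xs. set xs \<subseteq> A \<and> Cs = map (\<lambda>x. \<theta> `` {x}) xs"
    using assms
  proof (induction Cs)
    case (Cons C Cs)
    then obtain x xs where "x \<in> A" "C = \<theta> `` {x}" "set xs \<subseteq> A" "Cs = map (\<lambda>x. \<theta> `` {x}) xs"
      by (auto elim: quotientE)
    then show ?case by (intro exI[of _ "x # xs"]) auto
  qed simp
  then show thesis using that by blast
qed

lemma algebra_quotient_alg:
  assumes "algebra S A" "congruence S A \<theta>"
  shows "algebra S (quotient_alg A \<theta>)"
  unfolding algebra_def closed_under_ops_def
proof (intro conjI ballI allI impI)
  show "carr (quotient_alg A \<theta>) \<noteq> {}"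
    using assms(1) by (auto simp: algebra_def quotient_def)
  fix f Cs assume f: "f \<in> ops S" "length Cs = arity S f \<and> set Cs \<subseteq> carr (quotient_alg A \<theta>)"
  then obtain xs where xs: "set xs \<subseteq> carr A" "Cs = map (\<lambda>x. \<theta> `` {x}) xs"
    using quotient_list_representatives[of Cs "carr A" \<theta>] by auto
  then show "interp (quotient_alg A \<theta>) f Cs \<in> carr (quotient_alg A \<theta>)"
    using f quotient_alg_interp[OF assms(2), of f xs] algebra_interp[OF assms(1), of f xs]
    by (simp add: quotientI)
qed

text \<open>The map \<open>g\<close> applies \<open>h\<close> to a chosen element of the class; as
  \<open>h\<close> is constant on classes, the choice does not matter.\<close>

lemma quotient_alg_factor:
  assumes A: "algebra S A" and c: "congruence S A \<theta>" and h: "h \<in> alg_hom S A B"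
    and ker: "\<And>x y. (x, y) \<in> \<theta> \<Longrightarrow> h x = h y"
  obtains g where "g \<in> alg_hom S (quotient_alg A \<theta>) B" "\<And>x. x \<in> carr A \<Longrightarrow> g (\<theta> `` {x}) = h x"
proof -
  have e: "equiv (carr A) \<theta>" by (rule congruence_equiv[OF c])
  define g where "g C = h (SOME x. x \<in> C)" for C
  have g: "g (\<theta> `` {x}) = h x" if "x \<in> carr A" for x
    using someI[of "\<lambda>y. y \<in> \<theta> `` {x}" x] equiv_class_self[OF e that] ker
    by (auto simp: g_def)
  have "g \<in> alg_hom S (quotient_alg A \<theta>) B"
  proof (rule alg_homI)
    fix C assume "C \<in> carr (quotient_alg A \<theta>)"
    then show "g C \<in> carr B" using g alg_hom_carr[OF h] by (auto elim!: quotientE)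
  next
    fix f Cs assume f: "f \<in> ops S" "length Cs = arity S f" "set Cs \<subseteq> carr (quotient_alg A \<theta>)"
    then obtain xs where xs: "set xs \<subseteq> carr A" "Cs = map (\<lambda>x. \<theta> `` {x}) xs"
      using quotient_list_representatives[of Cs "carr A" \<theta>] by auto
    have len: "length xs = arity S f" using f xs by simp
    have "map g Cs = map h xs" using xs g by auto
    then show "g (interp (quotient_alg A \<theta>) f Cs) = interp B f (map g Cs)"
      using xs(2) quotient_alg_interp[OF c f(1) len xs(1)] g[OF algebra_interp[OF A f(1) len xs(1)]]
        alg_hom_interp[OF h f(1) len xs(1)] by metis
  qed
  then show thesis using that g by blast
qed

section \<open>Membership of quotients in the quasivariety\<close>

text \<open>This is closure under subdirect products, stated without forming products. If
  \<open>v\<close> satisfied the premises but gave the two sides of the conclusion distinct values,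
  some \<open>h\<close> would separate these values, and \<open>h \<circ> v\<close> would refute the
  same quasiequation in \<open>B i\<close>.\<close>

lemma in_quasivariety_separated:
  fixes B :: "'i \<Rightarrow> ('f, 'b) alg"
  assumes \<Phi>: "quasiequations S \<Phi>" and C: "algebra S C"
    and sep: "\<And>x y. x \<in> carr C \<Longrightarrow> y \<in> carr C \<Longrightarrow> x \<noteq> y \<Longrightarrow>
      \<exists>i. \<exists>h \<in> alg_hom S C (B i). in_quasivariety S \<Phi> (B i) \<and> h x \<noteq> h y"
  shows "in_quasivariety S \<Phi> C"
proof -
  have "valid_in C \<Sigma> {e}" if e: "(\<Sigma>, e) \<in> \<Phi>" for \<Sigma> e
  proof -
    obtain s t where st: "e = (s, t)" by force
    have us: "universal_sentence S \<Sigma> {e}" using \<Phi> e unfolding quasiequations_def by auto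
    have "eval C v s = eval C v t"
      if v: "range v \<subseteq> carr C" "\<forall>(s, t) \<in> \<Sigma>. eval C v s = eval C v t" for v
    proof (rule ccontr)
      have terms: "s \<in> terms S UNIV" "t \<in> terms S UNIV"
        using us st by (auto simp: universal_sentence_def equations_def)
      assume "eval C v s \<noteq> eval C v t"
      then obtain i h where h: "h \<in> alg_hom S C (B i)" "in_quasivariety S \<Phi> (B i)"
          "h (eval C v s) \<noteq> h (eval C v t)"
        using sep eval_carr[OF C _ v(1)] terms by blast
      note ev = alg_hom_eval[OF h(1) C v(1)]
      have "range (h \<circ> v) \<subseteq> carr (B i)"
        using v(1) alg_hom_carr[OF h(1)] by auto
      moreover have "\<forall>(s, t) \<in> \<Sigma>. eval (B i) (h \<circ> v) s = eval (B i) (h \<circ> v) t"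
      proof clarify
        fix s t assume "(s, t) \<in> \<Sigma>"
        moreover from this have "s \<in> terms S UNIV" "t \<in> terms S UNIV"
          using us by (auto simp: universal_sentence_def equations_def)
        ultimately show "eval (B i) (h \<circ> v) s = eval (B i) (h \<circ> v) t"
          using v(2) ev[of s] ev[of t] by fastforce
      qed
      moreover have "valid_in (B i) \<Sigma> {e}"
        using h(2) e unfolding in_quasivariety_def by auto
      ultimately have "eval (B i) (h \<circ> v) s = eval (B i) (h \<circ> v) t"
        unfolding valid_in_def st by blast
      then show False using h(3) ev terms by simp
    qed
    then show ?thesis unfolding valid_in_def st by blast
  qed
  then show ?thesis using C unfolding in_quasivariety_def by auto
qed

lemma congruence_kernel:
  assumes A: "algebra S A" and h: "h \<in> alg_hom S A B"
  shows "congruence S A {(x, y). x \<in> carr A \<and> y \<in> carr A \<and> h x = h y}" (is "congruence S A ?K")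
  unfolding congruence_def
proof (intro conjI ballI allI impI)
  show "equiv (carr A) ?K"
    by (rule equivI) (auto simp: refl_on_def sym_def trans_def)
  fix f xs ys assume f: "f \<in> ops S" and l: "length xs = arity S f \<and> list_all2 (\<lambda>x y. (x, y) \<in> ?K) xs ys"
  then have "length ys = arity S f" "set xs \<subseteq> carr A" "set ys \<subseteq> carr A" "map h xs = map h ys"
    by (auto simp: list_all2_conv_all_nth in_set_conv_nth intro: nth_equalityI)
  then show "(interp A f xs, interp A f ys) \<in> ?K"
    using f l by (simp add: algebra_interp[OF A] alg_hom_interp[OF h])
qed

text \<open>The map induced on kernel classes is injective, so \<open>B\<close> alone, as a constant
  family over \<open>unit\<close>, separates the points of the quotient.\<close>

lemma in_quasivariety_kernel_quotient:
  assumes \<Phi>: "quasiequations S \<Phi>" and A: "algebra S A" and h: "h \<in> alg_hom S A B"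
    and B: "in_quasivariety S \<Phi> B"
  shows "in_quasivariety S \<Phi> (quotient_alg A {(x, y). x \<in> carr A \<and> y \<in> carr A \<and> h x = h y})"
    (is "in_quasivariety S \<Phi> (quotient_alg A ?K)")
proof -
  have c: "congruence S A ?K" by (rule congruence_kernel[OF A h])
  obtain g where g: "g \<in> alg_hom S (quotient_alg A ?K) B" "\<And>x. x \<in> carr A \<Longrightarrow> g (?K `` {x}) = h x"
    using quotient_alg_factor[OF A c h] by blast
  have "g x \<noteq> g y" if "x \<in> carr A // ?K" "y \<in> carr A // ?K" "x \<noteq> y" for x y
    using that g(2) by (force elim!: quotientE)
  then show ?thesis
    using g(1) B by (intro in_quasivariety_separated[OF \<Phi> algebra_quotient_alg[OF A c], of "\<lambda>_::unit. B"]) auto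
qed

text \<open>All classes coincide, so there are no points to separate and the separation criterion
  applies vacuously. This supplies a member of the family that defines the least relative
  congruence.\<close>

lemma in_quasivariety_total_quotient:
  assumes \<Phi>: "quasiequations S \<Phi>" and A: "algebra S A"
  shows "congruence S A (carr A \<times> carr A)"
    and "in_quasivariety S \<Phi> (quotient_alg A (carr A \<times> carr A))"
proof -
  show c: "congruence S A (carr A \<times> carr A)"
    unfolding congruence_def
  proof (intro conjI ballI allI impI)
    show "equiv (carr A) (carr A \<times> carr A)"
      by (rule equivI) (auto simp: refl_on_def sym_def trans_def)
    fix f xs ys assume f: "f \<in> ops S"
      and l: "length xs = arity S f \<and> list_all2 (\<lambda>x y. (x, y) \<in> carr A \<times> carr A) xs ys"
    then have "length ys = arity S f" "set xs \<subseteq> carr A" "set ys \<subseteq> carr A"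
      by (auto simp: list_all2_conv_all_nth in_set_conv_nth)
    then show "(interp A f xs, interp A f ys) \<in> carr A \<times> carr A"
      using f l by (simp add: algebra_interp[OF A])
  qed
  have "x = y" if "x \<in> carr A // (carr A \<times> carr A)" "y \<in> carr A // (carr A \<times> carr A)" for x y
    using that by (auto elim!: quotientE)
  then show "in_quasivariety S \<Phi> (quotient_alg A (carr A \<times> carr A))"
    by (intro in_quasivariety_separated[OF \<Phi> algebra_quotient_alg[OF A c]]) auto
qed

section \<open>Least relative congruences and the universal property of their quotients\<close>

lemma least_rel_congruence_least:
  assumes "congruence S A \<theta>" "H \<subseteq> \<theta>" "in_quasivariety S \<Phi> (quotient_alg A \<theta>)"
  shows "least_rel_congruence S \<Phi> A H \<subseteq> \<theta>"
  using assms unfolding least_rel_congruence_def by blast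

lemma least_rel_congruence_contains: "H \<subseteq> least_rel_congruence S \<Phi> A H"
  unfolding least_rel_congruence_def by blast

lemma congruence_least_rel_congruence:
  assumes \<Phi>: "quasiequations S \<Phi>" and A: "algebra S A" and H: "H \<subseteq> carr A \<times> carr A"
  shows "congruence S A (least_rel_congruence S \<Phi> A H)"
proof -
  define R where "R = {\<theta>. congruence S A \<theta> \<and> H \<subseteq> \<theta> \<and> in_quasivariety S \<Phi> (quotient_alg A \<theta>)}"
  \<comment> \<open>The intersection of an empty family would be the universal relation. The total
    relation on \<open>carr A\<close> shows that the family is nonempty and bounds the intersection
    by the carrier.\<close>
  have ne: "carr A \<times> carr A \<in> R"
    using in_quasivariety_total_quotient[OF \<Phi> A] H by (simp add: R_def)
  have eq: "equiv (carr A) \<theta>" if "\<theta> \<in> R" for \<theta>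
    using that congruence_equiv by (auto simp: R_def)
  have "equiv (carr A) (\<Inter>R)"
  proof (rule equivI)
    show "\<Inter>R \<subseteq> carr A \<times> carr A" using ne by blast
    show "refl_on (carr A) (\<Inter>R)"
      using eq unfolding refl_on_def equiv_def by blast
    show "sym (\<Inter>R)"
      using eq unfolding sym_def equiv_def by blast
    show "trans (\<Inter>R)"
      using eq unfolding trans_def equiv_def by blast
  qed
  moreover have "(interp A f xs, interp A f ys) \<in> \<Inter>R"
    if "f \<in> ops S" "length xs = arity S f" "list_all2 (\<lambda>x y. (x, y) \<in> \<Inter>R) xs ys" for f xs ys
  proof
    fix \<theta> assume \<theta>: "\<theta> \<in> R"
    have "list_all2 (\<lambda>x y. (x, y) \<in> \<theta>) xs ys"
      using that(3) by (rule list_all2_mono) (use \<theta> in blast)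
    then show "(interp A f xs, interp A f ys) \<in> \<theta>"
      using \<theta> that unfolding R_def congruence_def by blast
  qed
  ultimately show ?thesis
    unfolding least_rel_congruence_def R_def[symmetric] by (simp add: congruence_def)
qed

text \<open>The quotient by an intersection is a subdirect product of the quotients by its members:
  representatives of distinct classes form a pair omitted by some member \<open>\<theta>\<close>,
  and the projection to the quotient by \<open>\<theta>\<close> separates the classes. The relations
  themselves index the family.\<close>

lemma in_quasivariety_least_rel_quotient:
  assumes \<Phi>: "quasiequations S \<Phi>" and A: "algebra S A" and H: "H \<subseteq> carr A \<times> carr A"
  shows "in_quasivariety S \<Phi> (quotient_alg A (least_rel_congruence S \<Phi> A H))"
proof -
  define L where "L = least_rel_congruence S \<Phi> A H"
  have c: "congruence S A L"
    unfolding L_def by (rule congruence_least_rel_congruence[OF assms])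
  show ?thesis
    unfolding L_def[symmetric]
  proof (rule in_quasivariety_separated[OF \<Phi> algebra_quotient_alg[OF A c], of "quotient_alg A"])
    fix C D assume "C \<in> carr (quotient_alg A L)" "D \<in> carr (quotient_alg A L)" "C \<noteq> D"
    then obtain x y where xy: "x \<in> carr A" "y \<in> carr A" "C = L `` {x}" "D = L `` {y}" "C \<noteq> D"
      unfolding carr_quotient_alg by (elim quotientE)
    then have "(x, y) \<notin> L"
      using equiv_class_eq[OF congruence_equiv[OF c]] by metis
    then obtain \<theta> where \<theta>: "congruence S A \<theta>" "H \<subseteq> \<theta>" "in_quasivariety S \<Phi> (quotient_alg A \<theta>)"
        "(x, y) \<notin> \<theta>"
      unfolding L_def least_rel_congruence_def by blast
    note e = congruence_equiv[OF \<theta>(1)]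
    have "L \<subseteq> \<theta>" unfolding L_def by (rule least_rel_congruence_least[OF \<theta>(1-3)])
    then have "\<theta> `` {a} = \<theta> `` {b}" if "(a, b) \<in> L" for a b
      using equiv_class_eq[OF e] that by blast
    then obtain g where g: "g \<in> alg_hom S (quotient_alg A L) (quotient_alg A \<theta>)"
        "\<And>x. x \<in> carr A \<Longrightarrow> g (L `` {x}) = \<theta> `` {x}"
      using quotient_alg_factor[OF A c quotient_alg_hom[OF \<theta>(1)]] by blast
    then have "g C \<noteq> g D"
      using xy \<theta>(4) eq_equiv_class[OF _ e] by metis
    then show "\<exists>\<theta>. \<exists>h \<in> alg_hom S (quotient_alg A L) (quotient_alg A \<theta>).
        in_quasivariety S \<Phi> (quotient_alg A \<theta>) \<and> h C \<noteq> h D"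
      using g(1) \<theta>(3) by blast
  qed
qed

text \<open>The kernel of \<open>h\<close> is a relative congruence containing \<open>H\<close>,
  hence it contains the least one. For a term algebra and empty \<open>H\<close> this is the
  universal property of the free algebra; for a free algebra it is that of the algebra presented by
  \<open>H\<close>.\<close>

lemma least_rel_quotient_factor:
  assumes \<Phi>: "quasiequations S \<Phi>" and A: "algebra S A" and H: "H \<subseteq> carr A \<times> carr A"
    and h: "h \<in> alg_hom S A B" and B: "in_quasivariety S \<Phi> B"
    and ker: "\<And>x y. (x, y) \<in> H \<Longrightarrow> h x = h y"
  obtains g where "g \<in> alg_hom S (quotient_alg A (least_rel_congruence S \<Phi> A H)) B"
    "\<And>x. x \<in> carr A \<Longrightarrow> g (least_rel_congruence S \<Phi> A H `` {x}) = h x"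
proof -
  let ?K = "{(x, y). x \<in> carr A \<and> y \<in> carr A \<and> h x = h y}"
  have "H \<subseteq> ?K" using H ker by auto
  then have "least_rel_congruence S \<Phi> A H \<subseteq> ?K"
    by (rule least_rel_congruence_least[OF congruence_kernel[OF A h] _
          in_quasivariety_kernel_quotient[OF \<Phi> A h B]])
  then have "\<And>x y. (x, y) \<in> least_rel_congruence S \<Phi> A H \<Longrightarrow> h x = h y" by blast
  then show thesis
    using quotient_alg_factor[OF A congruence_least_rel_congruence[OF \<Phi> A H] h] that by metis
qed

section \<open>Universal completeness from embeddings into the free algebra\<close>

theorem theorem3p3:
  fixes S :: "'f signature" and \<Phi> :: "('f eqn set \<times> 'f eqn) set"
  assumes "quasiequations S \<Phi>"
    and "all_finitely_presented_exact S \<Phi>"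
  shows "universally_complete TYPE('a) S \<Phi>"
  unfolding universally_complete_def valid_in_def
proof (intro allI impI, elim conjE)
  fix \<Sigma> \<Delta> and A :: "('f, 'a) alg" and v
  assume us: "universal_sentence S \<Sigma> \<Delta>" and adm: "admissible S \<Phi> \<Sigma> \<Delta>"
    and A: "in_quasivariety S \<Phi> A" and v: "range v \<subseteq> carr A"
    and sat: "\<forall>(s, t) \<in> \<Sigma>. eval A v s = eval A v t"
  note \<Phi> = assms(1)
  define T where "T = fst ` (\<Sigma> \<union> \<Delta>) \<union> snd ` (\<Sigma> \<union> \<Delta>)"
  have "finite T" "T \<subseteq> terms S UNIV"
    using us by (auto simp: T_def universal_sentence_def equations_def)
  moreover have "\<forall>t\<in>T. \<exists>X. finite X \<and> t \<in> terms S X"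
    using \<open>T \<subseteq> terms S UNIV\<close> term_finite_vars[of _ S UNIV] by auto
  ultimately obtain X0 where X0: "finite X0" "T \<subseteq> terms S X0"
    using finite_terms_finite_vars[of T S] by metis
  \<comment> \<open>Adding \<open>0\<close> keeps the set of generators nonempty, so that the term
    algebra over \<open>X\<close> is an algebra even if no variables and no constants occur. It also
    provides a default variable for \<open>w\<close> below.\<close>
  define X where "X = insert 0 X0"
  have X: "finite X" "0 \<in> X" "T \<subseteq> terms S X"
    using X0 terms_mono[of _ S X0 X] by (auto simp: X_def)
  have tX: "s \<in> terms S X" "t \<in> terms S X" if "(s, t) \<in> \<Sigma> \<union> \<Delta>" for s t
    using that X(3) by (force simp: T_def)+
  let ?T = "term_alg S X"
  have T: "algebra S ?T" "carr ?T = terms S X"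
    using X(2) algebra_term_alg[of X S] by (auto simp: term_alg_def)
  define \<theta> where "\<theta> = least_rel_congruence S \<Phi> ?T {}"
  define F where "F = quotient_alg ?T \<theta>"
  have F_free: "F = free_alg S \<Phi> X" by (simp add: F_def \<theta>_def free_alg_def)
  have \<theta>: "congruence S ?T \<theta>"
    unfolding \<theta>_def by (rule congruence_least_rel_congruence[OF \<Phi> T(1)]) simp
  have F: "algebra S F" unfolding F_def by (rule algebra_quotient_alg[OF T(1) \<theta>])
  have q: "(\<lambda>t. \<theta> `` {t}) \<in> alg_hom S ?T F"
    unfolding F_def by (rule quotient_alg_hom[OF \<theta>])
  \<comment> \<open>The premises become relations between elements of the free algebra on
    \<open>X\<close>.\<close>
  define H where "H = (\<lambda>(s, t). (\<theta> `` {s}, \<theta> `` {t})) ` \<Sigma>"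
  have qF: "\<theta> `` {t} \<in> carr F" if "t \<in> terms S X" for t
    using alg_hom_carr[OF q] T(2) that by simp
  have H: "finite H" "H \<subseteq> carr F \<times> carr F"
    using us qF[OF tX(1)] qF[OF tX(2)] by (fastforce simp: H_def universal_sentence_def)+
  define \<eta> where "\<eta> = least_rel_congruence S \<Phi> F H"
  define P where "P = quotient_alg F \<eta>"
  have \<eta>: "congruence S F \<eta>"
    unfolding \<eta>_def by (rule congruence_least_rel_congruence[OF \<Phi> F H(2)])
  have P: "in_quasivariety S \<Phi> P"
    unfolding P_def \<eta>_def by (rule in_quasivariety_least_rel_quotient[OF \<Phi> F H(2)])
  define p where "p = (\<lambda>t. \<eta> `` {\<theta> `` {t}})"
  have p: "p \<in> alg_hom S ?T P"
    using alg_hom_comp[OF quotient_alg_hom[OF \<eta>] q] by (simp add: P_def p_def comp_def)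
  have p\<Sigma>: "p s = p t" if "(s, t) \<in> \<Sigma>" for s t
  proof -
    have "(\<theta> `` {s}, \<theta> `` {t}) \<in> H" using that unfolding H_def by (rule rev_image_eqI) simp
    then have "(\<theta> `` {s}, \<theta> `` {t}) \<in> \<eta>"
      unfolding \<eta>_def by (rule subsetD[OF least_rel_congruence_contains])
    then show ?thesis unfolding p_def by (rule equiv_class_eq[OF congruence_equiv[OF \<eta>]])
  qed
  \<comment> \<open>\<open>P\<close> is literally a presented quotient, so the identity is the
    required isomorphism; its elements are classes of classes of terms, the carrier type over which
    exactness is assumed.\<close>
  have "alg_iso S P P"
    unfolding alg_iso_def by (rule bexI[of _ id]) (auto intro: alg_homI)
  then have "finitely_presented S \<Phi> P"
    using P X(1) H unfolding finitely_presented_def P_def \<eta>_def F_free by blast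
  then have "exact S \<Phi> P"
    using assms(2) unfolding all_finitely_presented_exact_def by blast
  let ?W = "free_alg S \<Phi> UNIV"
  obtain U h where U: "subuniverse S ?W U" and h: "h \<in> alg_hom S P (?W\<lparr>carr := U\<rparr>)"
      and bij: "bij_betw h (carr P) U"
    using \<open>exact S \<Phi> P\<close> unfolding exact_def subalgebra_def alg_iso_def by auto
  \<comment> \<open>A subalgebra keeps the operations of the free algebra, so only the codomain is
    enlarged.\<close>
  have hW: "h \<in> alg_hom S P ?W"
    using h U unfolding alg_hom_def subuniverse_def by auto
  have W: "algebra S ?W"
    unfolding free_alg_def
    by (intro algebra_quotient_alg algebra_term_alg congruence_least_rel_congruence[OF \<Phi>]) auto
  \<comment> \<open>A substitution must be defined on all variables. Those outside \<open>X\<close>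
    are sent to the image of the generator \<open>Var 0\<close>; this choice has no effect on terms
    over \<open>X\<close>.\<close>
  define w where "w x = h (p (Var (if x \<in> X then x else 0)))" for x
  have "range w \<subseteq> carr ?W"
    using X(2) T(2)
    by (auto simp: w_def intro!: alg_hom_carr[OF hW] alg_hom_carr[OF p] terms.intros)
  then have \<sigma>: "eval ?W w \<in> alg_hom S (term_alg S UNIV) ?W"
    by (rule eval_alg_hom[OF W])
  have \<sigma>p: "eval ?W w t = h (p t)" if "t \<in> terms S X" for t
    using term_alg_hom_eq_eval[OF alg_hom_comp[OF hW p] that, of w] by (simp add: w_def)
  have "\<forall>(s, t) \<in> \<Sigma>. eval ?W w s = eval ?W w t"
  proof clarify
    fix s t assume "(s, t) \<in> \<Sigma>"
    then show "eval ?W w s = eval ?W w t" using tX[of s t] \<sigma>p p\<Sigma> by simp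
  qed
  then obtain s t where st: "(s, t) \<in> \<Delta>" "eval ?W w s = eval ?W w t"
    using adm \<sigma> unfolding admissible_def by blast
  have stX: "s \<in> terms S X" "t \<in> terms S X" using tX st(1) by auto
  \<comment> \<open>Injectivity of the embedding reflects the equation from the free algebra back to
    \<open>P\<close>.\<close>
  have pst: "p s = p t"
  proof (rule inj_onD[OF bij_betw_imp_inj_on[OF bij]])
    show "h (p s) = h (p t)" using st(2) stX \<sigma>p by simp
  qed (use stX T(2) alg_hom_carr[OF p] in auto)
  have A': "algebra S A" using A by (simp add: in_quasivariety_def)
  have ev: "eval A v \<in> alg_hom S ?T A"
    using v by (intro eval_alg_hom[OF A']) auto
  \<comment> \<open>Freeness on \<open>X\<close>: with no relations imposed, evaluation under
    \<open>v\<close> factors through \<open>F\<close>, since \<open>A\<close> lies in the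
    quasivariety.\<close>
  obtain g where g: "g \<in> alg_hom S F A" "\<And>t. t \<in> terms S X \<Longrightarrow> g (\<theta> `` {t}) = eval A v t"
    using least_rel_quotient_factor[OF \<Phi> T(1) _ ev A, of "{}"]
    unfolding F_def \<theta>_def T(2) by auto
  \<comment> \<open>This is where \<open>v\<close> satisfying the premises enters: \<open>g\<close>
    respects the relations and hence descends to a map \<open>k\<close> on \<open>P\<close>.\<close>
  have "g x = g y" if "(x, y) \<in> H" for x y
    using that sat g(2) tX by (force simp: H_def)
  then obtain k where k: "\<And>x. x \<in> carr F \<Longrightarrow> k (\<eta> `` {x}) = g x"
    using least_rel_quotient_factor[OF \<Phi> F H(2) g(1) A] unfolding \<eta>_def by blast
  \<comment> \<open>Evaluation under \<open>v\<close> is \<open>k\<close> after \<open>p\<close> on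
    terms over \<open>X\<close>, so terms identified in \<open>P\<close> have equal values in
    \<open>A\<close>.\<close>
  have kp: "k (p r) = eval A v r" if "r \<in> terms S X" for r
    using that k qF g(2) by (simp add: p_def)
  have "eval A v s = eval A v t"
    using kp[OF stX(1)] kp[OF stX(2)] pst by simp
  then show "\<exists>(s, t) \<in> \<Delta>. eval A v s = eval A v t" using st(1) by blast
qed

end
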